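(* Let $k\ge 3$, and let $t\ge c$ be fixed. (1) If $c\ge \binom{k-1}{2}+2$, then $\mathrm{sat}_t(n,\mathcal{C}_c(K_k))=\Theta(n\log n)$. (2) If $c\le \binom{k-1}{2}+1$, then $\mathrm{sat}_t(n,\mathcal{C}_c(K_k))=\Theta(n)$.
   Context: All graphs are finite and simple; $k$, $t$, $c$ are integers, and the asymptotics are as $n\to\infty$ with $k,c,t$ fixed. Write $[t]=\{1,\dots,t\}$. A $t$-edge-coloring of a graph $G$ is an arbitrary function $E(G)\to[t]$ (not necessarily proper). Given a family $\mathcal{C}$ of graphs edge-colored from $[t]$, a $t$-edge-colored graph $G$ is $(\mathcal{C},t)$-saturated if $G$ contains no member of $\mathcal{C}$ as a colored subgraph (not necessarily induced, colors matching), but for every non-edge $e\in E(\overline{G})$ and every color $i\in[t]$, adding $e$ to $G$ in color $i$ creates a colored subgraph that is a member of $\mathcal{C}$. The number $\mathrm{sat}_t(n,\mathcal{C})$ is the minimum number of edges in a $(\mathcal{C},t)$-saturated graph on $n$ vertices. For a graph $H$, $\mathcal{C}_r(H)$ is the family of all edge-colorings of $H$ with colors from $[t]$ that use exactly $r$ colors. $K_k$ is the complete graph on $k$ vertices.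
   Formalization: The formal theorem also assumes 1 ≤ c ≤ binom(k,2), i.e. that some coloring of K_k uses exactly c colors; otherwise the family is empty and sat_t(n, ∅) = binom(n,2) for t ≥ 1 (and 0 for t = 0), so the stated claim fails. *)

theory Defs
  imports Complex_Main "HOL-Library.Landau_Symbols"
begin

record 'a graph =
  verts :: "'a set"
  edges :: "'a set set"

text \<open>The values of \<open>colour\<close> outside \<open>edges\<close> are irrelevant.\<close>

record 'a cgraph = "'a graph" +
  colour :: "'a set \<Rightarrow> nat"

definition vertex_pairs :: "'a set \<Rightarrow> 'a set set" where
  "vertex_pairs V = {e. e \<subseteq> V \<and> card e = 2}"

definition simple_graph :: "('a, 'b) graph_scheme \<Rightarrow> bool" where
  "simple_graph G \<longleftrightarrow> finite (verts G) \<and> edges G \<subseteq> vertex_pairs (verts G)"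

definition edge_coloured :: "nat \<Rightarrow> 'a cgraph \<Rightarrow> bool" where
  "edge_coloured t G \<longleftrightarrow> simple_graph G \<and> colour G ` edges G \<subseteq> {1..t}"

text \<open>\<open>G\<close> contains a (not necessarily induced) copy of \<open>H\<close>, with the same colours.\<close>

definition contains_copy :: "'a cgraph \<Rightarrow> 'b cgraph \<Rightarrow> bool" where
  "contains_copy G H \<longleftrightarrow>
     (\<exists>f. inj_on f (verts H) \<and> f ` verts H \<subseteq> verts G \<and>
          (\<forall>e\<in>edges H. f ` e \<in> edges G \<and> colour G (f ` e) = colour H e))"

definition add_edge :: "'a cgraph \<Rightarrow> 'a set \<Rightarrow> nat \<Rightarrow> 'a cgraph" where
  "add_edge G e i = G\<lparr>edges := insert e (edges G), colour := (colour G)(e := i)\<rparr>"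

definition saturated :: "'b cgraph set \<Rightarrow> nat \<Rightarrow> 'a cgraph \<Rightarrow> bool" where
  "saturated \<C> t G \<longleftrightarrow>
     edge_coloured t G \<and>
     (\<forall>H\<in>\<C>. \<not> contains_copy G H) \<and>
     (\<forall>e \<in> vertex_pairs (verts G) - edges G. \<forall>i\<in>{1..t}.
        \<exists>H\<in>\<C>. contains_copy (add_edge G e i) H)"

text \<open>
  Since \<open>n\<close>-vertex graphs are considered up to isomorphism, it is enough to take vertices in
  \<open>nat\<close>. If every member of \<open>\<C>\<close> has an edge, then the minimum is over a nonempty set: starting
  from the edgeless graph, add coloured edges as long as no member of \<open>\<C>\<close> arises.
\<close>

definition sat :: "nat \<Rightarrow> nat \<Rightarrow> 'b cgraph set \<Rightarrow> nat" where
  "sat t n \<C> =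
     (LEAST m. \<exists>G :: nat cgraph. saturated \<C> t G \<and> card (verts G) = n \<and> card (edges G) = m)"

definition colourings :: "nat \<Rightarrow> nat \<Rightarrow> 'a graph \<Rightarrow> 'a cgraph set" where
  "colourings t r H =
     {\<lparr>verts = verts H, edges = edges H, colour = \<chi>\<rparr> | \<chi>.
        \<chi> ` edges H \<subseteq> {1..t} \<and> card (\<chi> ` edges H) = r}"

definition complete_graph :: "nat \<Rightarrow> nat graph" where
  "complete_graph k = \<lparr>verts = {1..k}, edges = vertex_pairs {1..k}\<rparr>"

end

theory Submission
  imports Defs "HOL-Library.FuncSet" "HOL-Real_Asymp.Real_Asymp"
begin

text \<open>
  Both upper bounds come from one construction, and the two regimes differ only in how much the
  vertices of a large independent set must be told apart.

  Take an independent set \<open>I\<close> containing almost all vertices and a number of disjoint cliques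
  (gadgets) of size \<open>k - 2\<close>, each completely joined to \<open>I\<close>, with no edges between
  different gadgets. The largest clique has \<open>k - 1\<close> vertices, so nothing is forbidden yet. Adding an
  edge \<open>uv\<close> inside \<open>I\<close> in colour \<open>i\<close> turns each gadget together with \<open>u\<close> and \<open>v\<close> into a \<open>K\<^sub>k\<close>, and it
  suffices that one of these has exactly \<open>c\<close> colours (\<open>gadget_graph_blocked\<close>). Greedily adding further edges
  never uses such a pair, so \<open>s\<close> gadgets give at most \<open>s (k - 2) n\<close> edges
  (\<open>sat_le_gadgets\<close>). If \<open>c - 1 \<le> (k - 1) choose 2\<close>, all vertices of \<open>I\<close> can be
  attached to a gadget in the same way: one gadget for each colour \<open>i\<close>, in which \<open>c - 1\<close> colours
  other than \<open>i\<close> occur, is enough, and \<open>s = t\<close>. For larger \<open>c\<close> the vertices \<open>u\<close> and \<open>v\<close> must be attached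
  differently; using one gadget per colour and per binary digit of the vertex names gives
  \<open>s = t \<lceil>log\<^sub>2 n\<rceil>\<close>.

  Conversely, in a saturated graph any two non-adjacent vertices have a common neighbour, so there
  are no isolated vertices and at least \<open>n / 2\<close> edges. If \<open>c \<ge> ((k - 1) choose 2) + 2\<close>, then some common
  neighbour sees the two vertices in different colours, since otherwise one of them and the colour
  of the new edge already account for all colours of the created \<open>K\<^sub>k\<close>. Now
  choose a colour at each vertex \<open>x\<close> at random, and delete the neighbours of \<open>x\<close> joined to it
  in any other colour (an argument in the style of Hansel's lemma on coverings by bipartite graphs). The
  survivors form a clique, while a vertex of degree \<open>d\<close> survives with probability
  \<open>t ^ (- d)\<close>; so some clique has at least \<open>\<Sum>\<^sub>u t ^ (- d(u))\<close> vertices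
  (\<open>exists_large_clique\<close>). With fewer than a small multiple of \<open>n log n\<close> edges in total, convexity
  makes this clique so large that it alone has more edges than that.
\<close>

section \<open>Forbidden copies as vertex sets\<close>

lemma finite_vertex_pairs: "finite V \<Longrightarrow> finite (vertex_pairs V)"
  by (simp add: vertex_pairs_def)

lemma card_vertex_pairs: "finite V \<Longrightarrow> card (vertex_pairs V) = card V choose 2"
  by (simp add: vertex_pairs_def n_subsets)

lemma vertex_pairs_mono: "A \<subseteq> B \<Longrightarrow> vertex_pairs A \<subseteq> vertex_pairs B"
  by (auto simp: vertex_pairs_def)

lemma pair_in_vertex_pairs: "{u, v} \<in> vertex_pairs V \<longleftrightarrow> u \<in> V \<and> v \<in> V \<and> u \<noteq> v"
  by (auto simp: vertex_pairs_def card_2_iff card_insert_if)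

lemma vertex_pairsE:
  assumes "e \<in> vertex_pairs V"
  obtains u v where "e = {u, v}" "u \<noteq> v" "u \<in> V" "v \<in> V"
  using assms by (auto simp: vertex_pairs_def card_2_iff)

lemma vertex_pairs_image:
  assumes "inj_on f A"
  shows "vertex_pairs (f ` A) = (`) f ` vertex_pairs A"
proof
  show "vertex_pairs (f ` A) \<subseteq> (`) f ` vertex_pairs A"
  proof
    fix e assume "e \<in> vertex_pairs (f ` A)"
    then obtain u v where uv: "e = {u, v}" "u \<noteq> v" "u \<in> f ` A" "v \<in> f ` A"
      by (rule vertex_pairsE)
    then obtain a b where "a \<in> A" "b \<in> A" "u = f a" "v = f b" by auto
    with uv show "e \<in> (`) f ` vertex_pairs A"
      by (intro image_eqI[of _ _ "{a, b}"]) (auto simp: pair_in_vertex_pairs)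
  qed
  show "(`) f ` vertex_pairs A \<subseteq> vertex_pairs (f ` A)"
  proof safe
    fix e assume "e \<in> vertex_pairs A"
    then obtain a b where "e = {a, b}" "a \<noteq> b" "a \<in> A" "b \<in> A"
      by (rule vertex_pairsE)
    with assms show "f ` e \<in> vertex_pairs (f ` A)"
      by (auto simp: pair_in_vertex_pairs dest: inj_onD)
  qed
qed

text \<open>
  A family of all colourings of \<open>K\<^sub>k\<close> with exactly \<open>c\<close> colours is invariant under renaming the vertices,
  so a forbidden copy is determined by its vertex set in the host graph. Working with such sets
  removes embeddings from all later arguments.
\<close>

definition coloured_clique :: "nat \<Rightarrow> nat \<Rightarrow> 'a cgraph \<Rightarrow> 'a set \<Rightarrow> bool" where
  "coloured_clique k c G S \<longleftrightarrow> S \<subseteq> verts G \<and> card S = k \<and> vertex_pairs S \<subseteq> edges G \<and>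
     card (colour G ` vertex_pairs S) = c"

lemma contains_complete_colouring_iff:
  fixes G :: "'a cgraph"
  assumes G: "edge_coloured t G"
  shows "(\<exists>H\<in>colourings t c (complete_graph k). contains_copy G H) \<longleftrightarrow>
         (\<exists>S. coloured_clique k c G S)"
proof
  assume "\<exists>H\<in>colourings t c (complete_graph k). contains_copy G H"
  then obtain \<chi> f where \<chi>: "card (\<chi> ` vertex_pairs {1..k}) = c"
    and f: "inj_on f {1..k}" "f ` {1..k} \<subseteq> verts G"
    and e: "\<forall>e\<in>vertex_pairs {1..k}. f ` e \<in> edges G \<and> colour G (f ` e) = \<chi> e"
    by (auto simp: colourings_def complete_graph_def contains_copy_def)
  have "colour G ` vertex_pairs (f ` {1..k}) = \<chi> ` vertex_pairs {1..k}"
    unfolding vertex_pairs_image[OF f(1)] image_image using e by (intro image_cong) auto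
  moreover have "vertex_pairs (f ` {1..k}) \<subseteq> edges G"
    unfolding vertex_pairs_image[OF f(1)] using e by auto
  ultimately have "coloured_clique k c G (f ` {1..k})"
    unfolding coloured_clique_def using f \<chi> by (auto simp: card_image)
  then show "\<exists>S. coloured_clique k c G S" by blast
next
  assume "\<exists>S. coloured_clique k c G S"
  then obtain S where S: "S \<subseteq> verts G" "card S = k" "vertex_pairs S \<subseteq> edges G"
     "card (colour G ` vertex_pairs S) = c"
    by (auto simp: coloured_clique_def)
  have "finite S" using G S(1) by (auto simp: edge_coloured_def simple_graph_def intro: finite_subset)
  then obtain f where f: "bij_betw f {1..k} S"
    using ex_bij_betw_nat_finite_1[of S] S(2) by auto
  then have inj: "inj_on f {1..k}" and im: "f ` {1..k} = S" by (auto simp: bij_betw_def)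
  define \<chi> where "\<chi> = (\<lambda>e. colour G (f ` e))"
  have eq: "\<chi> ` vertex_pairs {1..k} = colour G ` vertex_pairs S"
    unfolding im[symmetric] vertex_pairs_image[OF inj] by (auto simp: \<chi>_def)
  have "\<chi> ` vertex_pairs {1..k} \<subseteq> {1..t}"
    using G S(3) unfolding eq edge_coloured_def by blast
  then have "\<lparr>verts = {1..k}, edges = vertex_pairs {1..k}, colour = \<chi>\<rparr>
      \<in> colourings t c (complete_graph k)"
    using eq S(4) by (auto simp: colourings_def complete_graph_def)
  moreover have "contains_copy G \<lparr>verts = {1..k}, edges = vertex_pairs {1..k}, colour = \<chi>\<rparr>"
    unfolding contains_copy_def
    using inj im S(1,3) vertex_pairs_image[OF inj] by (intro exI[of _ f]) (auto simp: \<chi>_def)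
  ultimately show "\<exists>H\<in>colourings t c (complete_graph k). contains_copy G H" by blast
qed

lemma edge_coloured_add_edge:
  assumes "edge_coloured t G" "e \<in> vertex_pairs (verts G)" "i \<in> {1..t}"
  shows "edge_coloured t (add_edge G e i)"
  using assms by (auto simp: edge_coloured_def simple_graph_def add_edge_def)

lemma saturated_complete_iff:
  "saturated (colourings t c (complete_graph k)) t G \<longleftrightarrow>
     edge_coloured t G \<and> (\<forall>S. \<not> coloured_clique k c G S) \<and>
     (\<forall>e \<in> vertex_pairs (verts G) - edges G. \<forall>i\<in>{1..t}.
        \<exists>S. coloured_clique k c (add_edge G e i) S)"
proof (cases "edge_coloured t G")
  case True
  have "(\<exists>H\<in>colourings t c (complete_graph k). contains_copy (add_edge G e i) H) \<longleftrightarrow>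
      (\<exists>S. coloured_clique k c (add_edge G e i) S)"
    if "e \<in> vertex_pairs (verts G) - edges G" "i \<in> {1..t}" for e i
    using contains_complete_colouring_iff edge_coloured_add_edge True that by blast
  moreover have "(\<forall>H\<in>colourings t c (complete_graph k). \<not> contains_copy G H) \<longleftrightarrow>
      (\<forall>S. \<not> coloured_clique k c G S)"
    using contains_complete_colouring_iff[OF True, of c k] by blast
  ultimately show ?thesis unfolding saturated_def by simp
qed (simp add: saturated_def)

section \<open>Greedy completion\<close>

definition coloured_subgraph :: "'a cgraph \<Rightarrow> 'a cgraph \<Rightarrow> bool" where
  "coloured_subgraph G G' \<longleftrightarrow> verts G \<subseteq> verts G' \<and> edges G \<subseteq> edges G' \<and>
     (\<forall>e\<in>edges G. colour G' e = colour G e)"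

lemma coloured_subgraph_trans:
  "coloured_subgraph G G' \<Longrightarrow> coloured_subgraph G' G'' \<Longrightarrow> coloured_subgraph G G''"
  by (auto simp: coloured_subgraph_def)

lemma coloured_clique_mono:
  assumes "coloured_subgraph G G'" "coloured_clique k c G S"
  shows "coloured_clique k c G' S"
proof -
  have "colour G' ` vertex_pairs S = colour G ` vertex_pairs S"
    using assms by (intro image_cong) (auto simp: coloured_subgraph_def coloured_clique_def)
  then show ?thesis using assms by (auto simp: coloured_subgraph_def coloured_clique_def)
qed

text \<open>
  Add coloured edges that create no forbidden copy for as long as possible; the number of non-edges
  drops at each step, and a graph in which the process is stuck is saturated.
\<close>

lemma exists_saturated_extension:
  fixes G :: "'a cgraph"
  assumes "edge_coloured t G" "\<And>S. \<not> coloured_clique k c G S"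
  shows "\<exists>G'. saturated (colourings t c (complete_graph k)) t G' \<and>
           coloured_subgraph G G' \<and> verts G' = verts G"
  using assms
proof (induction "card (vertex_pairs (verts G) - edges G)" arbitrary: G rule: less_induct)
  case (less G)
  show ?case
  proof (cases "saturated (colourings t c (complete_graph k)) t G")
    case True
    then show ?thesis by (intro exI[of _ G]) (auto simp: coloured_subgraph_def)
  next
    case False
    then obtain e i where e: "e \<in> vertex_pairs (verts G)" "e \<notin> edges G" and i: "i \<in> {1..t}"
      and free: "\<And>S. \<not> coloured_clique k c (add_edge G e i) S"
      using less.prems by (auto simp: saturated_complete_iff)
    have "finite (vertex_pairs (verts G))"
      using less.prems(1) by (auto simp: edge_coloured_def simple_graph_def finite_vertex_pairs)
    then have "card (vertex_pairs (verts (add_edge G e i)) - edges (add_edge G e i))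
        < card (vertex_pairs (verts G) - edges G)"
      using e by (intro psubset_card_mono) (auto simp: add_edge_def)
    from less.hyps[OF this edge_coloured_add_edge[OF less.prems(1) e(1) i] free]
    obtain G' where G': "saturated (colourings t c (complete_graph k)) t G'"
      "coloured_subgraph (add_edge G e i) G'" "verts G' = verts (add_edge G e i)" by blast
    moreover have "coloured_subgraph G (add_edge G e i)"
      using e(2) by (auto simp: coloured_subgraph_def add_edge_def)
    ultimately show ?thesis
      by (intro exI[of _ G']) (auto simp: add_edge_def intro: coloured_subgraph_trans)
  qed
qed

text \<open>
  The edgeless graph has a saturated extension, so the minimum defining the saturation number is
  over a nonempty set. This is what makes lower bounds for single graphs apply to the number.
\<close>

lemma sat_attained:
  assumes "k \<ge> 2"
  shows "\<exists>G :: nat cgraph. saturated (colourings t c (complete_graph k)) t G \<and> card (verts G) = n \<and>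
           card (edges G) = sat t n (colourings t c (complete_graph k))"
proof -
  let ?G = "\<lparr>verts = {..<n}, edges = {}, colour = \<lambda>_. 0\<rparr> :: nat cgraph"
  have "edge_coloured t ?G" by (auto simp: edge_coloured_def simple_graph_def)
  moreover have "\<not> coloured_clique k c ?G S" for S
  proof
    assume "coloured_clique k c ?G S"
    then have "finite S" "card S = k" "vertex_pairs S = {}"
      by (auto simp: coloured_clique_def intro: finite_subset)
    then have "k choose 2 = 0" using card_vertex_pairs[of S] by simp
    then show False using assms by (simp add: binomial_eq_0_iff)
  qed
  ultimately obtain G' where "saturated (colourings t c (complete_graph k)) t G'" "verts G' = verts ?G"
    using exists_saturated_extension by blast
  moreover define P where "P m \<longleftrightarrow> (\<exists>G :: nat cgraph. saturated (colourings t c (complete_graph k)) t G \<and>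
      card (verts G) = n \<and> card (edges G) = m)" for m
  ultimately have "P (card (edges G'))" by auto
  then have "P (LEAST m. P m)" by (rule LeastI[of P])
  then show ?thesis unfolding sat_def P_def .
qed

text \<open>
  An edge that creates a forbidden copy in every colour keeps doing so in every larger graph, so
  a greedy completion of \<open>G\<close> avoids all pairs in \<open>D\<close>.
\<close>

lemma sat_le_card_unblocked:
  fixes G :: "nat cgraph"
  assumes G: "edge_coloured t G" "\<And>S. \<not> coloured_clique k c G S" and n: "card (verts G) = n"
    and D: "\<And>e i. e \<in> D \<Longrightarrow> i \<in> {1..t} \<Longrightarrow>
               \<exists>S. coloured_clique k c (add_edge G e i) S"
  shows "sat t n (colourings t c (complete_graph k)) \<le> card (vertex_pairs (verts G) - D)"
proof -
  obtain G' where G': "saturated (colourings t c (complete_graph k)) t G'"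
      "coloured_subgraph G G'" "verts G' = verts G"
    using exists_saturated_extension[OF G] by blast
  have "sat t n (colourings t c (complete_graph k)) \<le> card (edges G')"
    unfolding sat_def
  proof (rule Least_le)
    show "\<exists>H :: nat cgraph. saturated (colourings t c (complete_graph k)) t H \<and>
        card (verts H) = n \<and> card (edges H) = card (edges G')"
      using G'(1,3) n by (intro exI[of _ G']) simp
  qed
  also have "edges G' \<subseteq> vertex_pairs (verts G) - D"
  proof
    fix e assume e: "e \<in> edges G'"
    have "e \<notin> D"
    proof
      assume "e \<in> D"
      moreover have "colour G' e \<in> {1..t}"
        using G'(1) e by (auto simp: saturated_def edge_coloured_def)
      ultimately obtain S where S: "coloured_clique k c (add_edge G e (colour G' e)) S"
        using D by blast
      have "coloured_subgraph (add_edge G e (colour G' e)) G'"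
        using G'(2) e by (auto simp: coloured_subgraph_def add_edge_def)
      from coloured_clique_mono[OF this S] G'(1) show False
        by (auto simp: saturated_complete_iff)
    qed
    moreover have "e \<in> vertex_pairs (verts G)"
      using G'(1,3) e by (auto simp: saturated_def edge_coloured_def simple_graph_def)
    ultimately show "e \<in> vertex_pairs (verts G) - D" by blast
  qed
  then have "card (edges G') \<le> card (vertex_pairs (verts G) - D)"
    using G(1) by (intro card_mono) (auto simp: edge_coloured_def simple_graph_def finite_vertex_pairs)
  finally show ?thesis .
qed

section \<open>Upper bounds: gadgets joined to an independent set\<close>

lemma card_pairs_meeting_le:
  assumes "finite W" "finite V"
  shows "card {e \<in> vertex_pairs V. e \<inter> W \<noteq> {}} \<le> card W * card V"
proof -
  have "{e \<in> vertex_pairs V. e \<inter> W \<noteq> {}} \<subseteq> (\<lambda>(x, y). {x, y}) ` (W \<times> V)"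
  proof
    fix e assume "e \<in> {e \<in> vertex_pairs V. e \<inter> W \<noteq> {}}"
    then obtain x where e: "e \<in> vertex_pairs V" "x \<in> e" "x \<in> W" by auto
    from e(1) obtain u v where "e = {u, v}" "u \<in> V" "v \<in> V" by (rule vertex_pairsE)
    with e(2,3) have "(u \<in> W \<and> e = {u, v}) \<or> (v \<in> W \<and> e = {v, u})" by auto
    then show "e \<in> (\<lambda>(x, y). {x, y}) ` (W \<times> V)"
      using \<open>u \<in> V\<close> \<open>v \<in> V\<close> by auto
  qed
  then have "card {e \<in> vertex_pairs V. e \<inter> W \<noteq> {}} \<le> card ((\<lambda>(x, y). {x, y}) ` (W \<times> V))"
    using assms by (intro card_mono) auto
  also have "\<dots> \<le> card (W \<times> V)" using assms by (intro card_image_le) auto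
  finally show ?thesis by (simp add: card_cartesian_product)
qed

text \<open>
  The vertices are \<open>0, \<dots>, n - 1\<close>; the first \<open>s m\<close> of them are cut into \<open>s\<close> gadgets, consecutive
  blocks of length \<open>m = k - 2\<close>, and the rest is the independent set.
\<close>

definition gadget :: "nat \<Rightarrow> nat \<Rightarrow> nat set" where
  "gadget m j = {j * m..<Suc j * m}"

text \<open>
  Colours on gadget \<open>j\<close> are prescribed by a pattern \<open>\<phi> j\<close> on pairs of positions. The vertices of a gadget
  occupy positions \<open>0, \<dots>, m - 1\<close>, and \<open>\<tau> j x \<ge> m\<close> is the type of the independent vertex \<open>x\<close> with respect to
  that gadget: vertices of equal type are joined to it in the same colours.
\<close>

definition gadget_position :: "nat \<Rightarrow> nat \<Rightarrow> (nat \<Rightarrow> nat \<Rightarrow> nat) \<Rightarrow> nat \<Rightarrow> nat \<Rightarrow> nat" where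
  "gadget_position m s \<tau> j x = (if x < s * m then x mod m else \<tau> j x)"

text \<open>
  Every edge meets exactly one gadget, and since gadget vertices precede independent ones, the
  least endpoint \<open>Min e\<close> reveals which one.
\<close>

definition gadget_graph ::
    "nat \<Rightarrow> nat \<Rightarrow> nat \<Rightarrow> (nat \<Rightarrow> nat \<Rightarrow> nat) \<Rightarrow> (nat \<Rightarrow> nat set \<Rightarrow> nat) \<Rightarrow> nat cgraph" where
  "gadget_graph m s n \<tau> \<phi> =
     \<lparr>verts = {..<n},
      edges = {e \<in> vertex_pairs {..<n}. \<exists>j<s. e \<subseteq> gadget m j \<union> {s * m..<n} \<and> e \<inter> gadget m j \<noteq> {}},
      colour = \<lambda>e. let j = Min e div m in \<phi> j (gadget_position m s \<tau> j ` e)\<rparr>"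

lemma in_gadget_iff: "m > 0 \<Longrightarrow> x \<in> gadget m j \<longleftrightarrow> x div m = j"
  using less_eq_div_iff_mult_less_eq[of m j x] div_less_iff_less_mult[of m x "Suc j"]
  unfolding gadget_def atLeastLessThan_iff by linarith

lemma gadget_subset: "j < s \<Longrightarrow> gadget m j \<subseteq> {..<s * m}"
  using mult_le_mono1[of "Suc j" s m] unfolding gadget_def by auto

lemma gadget_position_gadget:
  assumes "m > 0" "j < s"
  shows "inj_on (gadget_position m s \<tau> j') (gadget m j)"
    and "gadget_position m s \<tau> j' ` gadget m j = {..<m}"
proof -
  have eq: "gadget_position m s \<tau> j' x = x mod m" if "x \<in> gadget m j" for x
    using that gadget_subset[OF assms(2), of m] by (auto simp: gadget_position_def)
  show inj: "inj_on (gadget_position m s \<tau> j') (gadget m j)"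
    by (rule inj_onI) (metis eq in_gadget_iff[OF assms(1)] mult_div_mod_eq)
  show "gadget_position m s \<tau> j' ` gadget m j = {..<m}"
  proof (rule card_subset_eq)
    show "gadget_position m s \<tau> j' ` gadget m j \<subseteq> {..<m}" using eq assms by auto
    show "card (gadget_position m s \<tau> j' ` gadget m j) = card {..<m}"
      unfolding card_image[OF inj] by (simp add: gadget_def)
  qed simp
qed

lemma gadget_graph_edge_colour:
  assumes "m > 0" "j < s" "e \<in> vertex_pairs V" "e \<subseteq> gadget m j \<union> {s * m..<n}" "e \<inter> gadget m j \<noteq> {}"
  shows "colour (gadget_graph m s n \<tau> \<phi>) e = \<phi> j (gadget_position m s \<tau> j ` e)"
proof -
  have fin: "finite e" "e \<noteq> {}" using assms(3) by (auto simp: vertex_pairs_def card_2_iff)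
  obtain x where x: "x \<in> e" "x \<in> gadget m j" using assms(5) by auto
  have "Min e \<le> x" using fin x by simp
  also have "x < s * m" using x gadget_subset[OF assms(2)] by auto
  finally have "Min e \<in> gadget m j" using assms(4) Min_in[OF fin] by auto
  then have "Min e div m = j" using in_gadget_iff[OF assms(1)] by simp
  then show ?thesis by (simp add: gadget_graph_def)
qed

text \<open>
  A clique has at most one independent vertex, and its remaining vertices lie in a single gadget.
\<close>

lemma gadget_graph_no_clique:
  assumes "m > 0"
  shows "\<not> coloured_clique (m + 2) c (gadget_graph m s n \<tau> \<phi>) S"
proof
  assume "coloured_clique (m + 2) c (gadget_graph m s n \<tau> \<phi>) S"
  then have S: "S \<subseteq> {..<n}" "card S = m + 2"
    and E: "\<And>e. e \<in> vertex_pairs S \<Longrightarrow>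
        \<exists>j<s. e \<subseteq> gadget m j \<union> {s * m..<n} \<and> e \<inter> gadget m j \<noteq> {}"
    by (auto simp: coloured_clique_def gadget_graph_def)
  have finS: "finite S" using S(1) finite_subset by blast
  define A where "A = S \<inter> {..<s * m}"
  define B where "B = S - {..<s * m}"
  have "card B \<le> 1"
  proof (rule ccontr)
    assume "\<not> card B \<le> 1"
    then obtain u v where uv: "u \<in> B" "v \<in> B" "u \<noteq> v"
      by (metis One_nat_def card_le_Suc0_iff_eq finS finite_Diff B_def)
    then have "{u, v} \<in> vertex_pairs S" by (auto simp: pair_in_vertex_pairs B_def)
    from E[OF this] uv gadget_subset show False unfolding B_def by fastforce
  qed
  moreover have "card A \<le> m"
  proof (cases "A = {}")
    case False
    then obtain a where a: "a \<in> A" by auto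
    have "A \<subseteq> gadget m (a div m)"
    proof
      fix b assume b: "b \<in> A"
      show "b \<in> gadget m (a div m)"
      proof (cases "a = b")
        case False
        then have "{a, b} \<in> vertex_pairs S" using a b by (auto simp: pair_in_vertex_pairs A_def)
        from E[OF this] a b obtain j where "a \<in> gadget m j" "b \<in> gadget m j"
          by (auto simp: A_def)
        then show ?thesis using in_gadget_iff[OF assms] by simp
      qed (simp add: in_gadget_iff[OF assms])
    qed
    then have "card A \<le> card (gadget m (a div m))" by (intro card_mono) (auto simp: gadget_def)
    then show ?thesis by (simp add: gadget_def)
  qed simp
  moreover have "card S = card A + card B"
    unfolding A_def B_def using card_Int_Diff finS by blast
  ultimately show False using S(2) by simp
qed

text \<open>
  The new edge is the only pair that is not controlled by one of the two cliques formed by the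
  gadget with \<open>u\<close> or with \<open>v\<close>.
\<close>

lemma vertex_pairs_insert2:
  "vertex_pairs (insert u (insert v X)) =
     insert {u, v} (vertex_pairs (insert u X) \<union> vertex_pairs (insert v X))" if "u \<noteq> v"
proof
  show "vertex_pairs (insert u (insert v X)) \<subseteq>
     insert {u, v} (vertex_pairs (insert u X) \<union> vertex_pairs (insert v X))"
  proof
    fix e assume "e \<in> vertex_pairs (insert u (insert v X))"
    then obtain a b where "e = {a, b}" "a \<noteq> b" "a \<in> insert u (insert v X)" "b \<in> insert u (insert v X)"
      by (rule vertex_pairsE)
    then show "e \<in> insert {u, v} (vertex_pairs (insert u X) \<union> vertex_pairs (insert v X))"
      by (auto simp: pair_in_vertex_pairs)
  qed
  show "insert {u, v} (vertex_pairs (insert u X) \<union> vertex_pairs (insert v X)) \<subseteq>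
      vertex_pairs (insert u (insert v X))"
    using that vertex_pairs_mono[of "insert u X" "insert u (insert v X)"]
      vertex_pairs_mono[of "insert v X" "insert u (insert v X)"]
    by (auto simp: pair_in_vertex_pairs)
qed

text \<open>
  The colours of gadget \<open>j\<close> with \<open>u\<close> and \<open>v\<close> can be read off from the pattern: positions are injective
  on the gadget with either vertex, although possibly not with both, since \<open>u\<close> and \<open>v\<close> may have the
  same type.
\<close>

lemma gadget_graph_blocked:
  assumes m: "m > 0" and j: "j < s" and uv: "u \<in> {s * m..<n}" "v \<in> {s * m..<n}" "u \<noteq> v"
    and \<tau>: "\<tau> j u \<ge> m" "\<tau> j v \<ge> m"
    and c: "card (insert i (\<phi> j ` (vertex_pairs (insert (\<tau> j u) {..<m}) \<union>
                                  vertex_pairs (insert (\<tau> j v) {..<m})))) = c"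
  shows "coloured_clique (m + 2) c (add_edge (gadget_graph m s n \<tau> \<phi>) {u, v} i)
           (insert u (insert v (gadget m j)))"
proof -
  let ?G = "gadget_graph m s n \<tau> \<phi>" and ?X = "gadget m j"
  let ?p = "gadget_position m s \<tau> j"
  have X: "?X \<subseteq> {..<s * m}" using gadget_subset[OF j] .
  have one: "vertex_pairs (insert w ?X) \<subseteq> edges ?G \<and> {u, v} \<notin> vertex_pairs (insert w ?X) \<and>
      colour ?G ` vertex_pairs (insert w ?X) = \<phi> j ` vertex_pairs (insert (\<tau> j w) {..<m})"
    if w: "w \<in> {s * m..<n}" "\<tau> j w \<ge> m" for w
  proof -
    have wX: "w \<notin> ?X" using X w by auto
    have pw: "?p w = \<tau> j w" using w by (simp add: gadget_position_def)
    have inj: "inj_on ?p (insert w ?X)"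
      using gadget_position_gadget[OF m j, of \<tau> j] w pw wX by auto
    have im: "?p ` insert w ?X = insert (\<tau> j w) {..<m}"
      using gadget_position_gadget(2)[OF m j, of \<tau> j] pw by simp
    have e: "e \<subseteq> ?X \<union> {s * m..<n} \<and> e \<inter> ?X \<noteq> {}" if "e \<in> vertex_pairs (insert w ?X)" for e
    proof -
      from that obtain a b where "e = {a, b}" "a \<noteq> b" "a \<in> insert w ?X" "b \<in> insert w ?X"
        by (rule vertex_pairsE)
      then show ?thesis using w by auto
    qed
    have "colour ?G ` vertex_pairs (insert w ?X) = (\<lambda>e. \<phi> j (?p ` e)) ` vertex_pairs (insert w ?X)"
      using e by (intro image_cong refl gadget_graph_edge_colour[OF m j]) auto
    also have "\<dots> = \<phi> j ` vertex_pairs (?p ` insert w ?X)"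
      unfolding vertex_pairs_image[OF inj] by (simp add: image_image)
    finally have 1: "colour ?G ` vertex_pairs (insert w ?X) =
        \<phi> j ` vertex_pairs (insert (\<tau> j w) {..<m})" unfolding im .
    have sub: "insert w ?X \<subseteq> {..<n}" using X w by auto
    have 2: "vertex_pairs (insert w ?X) \<subseteq> edges ?G"
    proof
      fix e' assume e': "e' \<in> vertex_pairs (insert w ?X)"
      then have "e' \<in> vertex_pairs {..<n}" using vertex_pairs_mono[OF sub] by blast
      then show "e' \<in> edges ?G" using e[OF e'] j by (auto simp: gadget_graph_def)
    qed
    have "u \<notin> ?X" "v \<notin> ?X" using X uv by auto
    then have 3: "{u, v} \<notin> vertex_pairs (insert w ?X)"
      unfolding pair_in_vertex_pairs using uv(3) by blast
    show ?thesis using 1 2 3 by blast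
  qed
  have u: "vertex_pairs (insert u ?X) \<subseteq> edges ?G" "{u, v} \<notin> vertex_pairs (insert u ?X)"
      "colour ?G ` vertex_pairs (insert u ?X) = \<phi> j ` vertex_pairs (insert (\<tau> j u) {..<m})"
    using one[OF uv(1) \<tau>(1)] by auto
  have v: "vertex_pairs (insert v ?X) \<subseteq> edges ?G" "{u, v} \<notin> vertex_pairs (insert v ?X)"
      "colour ?G ` vertex_pairs (insert v ?X) = \<phi> j ` vertex_pairs (insert (\<tau> j v) {..<m})"
    using one[OF uv(2) \<tau>(2)] by auto
  let ?G' = "add_edge ?G {u, v} i"
  have same: "colour ?G' ` vertex_pairs (insert w ?X) = colour ?G ` vertex_pairs (insert w ?X)"
    if "{u, v} \<notin> vertex_pairs (insert w ?X)" for w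
    using that by (intro image_cong) (auto simp: add_edge_def)
  have "colour ?G' ` vertex_pairs (insert u (insert v ?X)) =
      insert i (\<phi> j ` (vertex_pairs (insert (\<tau> j u) {..<m}) \<union>
                                  vertex_pairs (insert (\<tau> j v) {..<m})))"
    unfolding vertex_pairs_insert2[OF uv(3)] image_insert image_Un
      same[OF u(2)] same[OF v(2)] u(3) v(3) by (simp add: add_edge_def)
  moreover have "vertex_pairs (insert u (insert v ?X)) \<subseteq> edges ?G'"
    unfolding vertex_pairs_insert2[OF uv(3)] using u(1) v(1) by (auto simp: add_edge_def)
  moreover have "card (insert u (insert v ?X)) = m + 2"
  proof -
    have "u \<notin> ?X" "v \<notin> ?X" "finite ?X" using X uv by (auto simp: gadget_def)
    then show ?thesis using uv(3) by (simp add: gadget_def)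
  qed
  moreover have "insert u (insert v ?X) \<subseteq> verts ?G'"
    using X uv by (auto simp: gadget_graph_def add_edge_def)
  ultimately show ?thesis using c by (simp add: coloured_clique_def)
qed

text \<open>
  All pairs inside the independent set are blocked, which leaves only the pairs that meet one of the
  \<open>s m\<close> gadget vertices. For \<open>n \<le> s m\<close> the independent set is empty and the bound still holds.
\<close>

lemma sat_le_gadgets:
  assumes m: "m > 0" and \<phi>: "\<And>j e. \<phi> j e \<in> {1..t}" and \<tau>: "\<And>j x. \<tau> j x \<ge> m"
    and H: "\<And>u v i. u < v \<Longrightarrow> v < n \<Longrightarrow> i \<in> {1..t} \<Longrightarrow>
       \<exists>j<s. card (insert i (\<phi> j ` (vertex_pairs (insert (\<tau> j u) {..<m}) \<union>
                                  vertex_pairs (insert (\<tau> j v) {..<m})))) = c"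
  shows "sat t n (colourings t c (complete_graph (m + 2))) \<le> s * m * n"
proof -
  let ?G = "gadget_graph m s n \<tau> \<phi>"
  define D where "D = vertex_pairs {s * m..<n}"
  have verts: "verts ?G = {..<n}" by (simp add: gadget_graph_def)
  have col: "edge_coloured t ?G"
    using \<phi> by (auto simp: edge_coloured_def simple_graph_def gadget_graph_def Let_def
        simp del: atLeastAtMost_iff)
  have "sat t n (colourings t c (complete_graph (m + 2))) \<le> card (vertex_pairs (verts ?G) - D)"
  proof (rule sat_le_card_unblocked[OF col])
    show "\<not> coloured_clique (m + 2) c ?G S" for S
      using gadget_graph_no_clique[OF m] .
    show "card (verts ?G) = n" using verts by simp
    fix e i assume e: "e \<in> D" and i: "i \<in> {1..t}"
    from e obtain u v where "e = {u, v}" "u \<noteq> v" "u \<in> {s * m..<n}" "v \<in> {s * m..<n}"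
      unfolding D_def by (rule vertex_pairsE)
    then obtain u v where uv: "e = {u, v}" "u < v" "u \<in> {s * m..<n}" "v \<in> {s * m..<n}"
      by (metis insert_commute nat_neq_iff)
    with H[of u v i] i obtain j where j: "j < s"
       "card (insert i (\<phi> j ` (vertex_pairs (insert (\<tau> j u) {..<m}) \<union>
                                  vertex_pairs (insert (\<tau> j v) {..<m})))) = c"
      by auto
    from gadget_graph_blocked[where \<tau> = \<tau> and \<phi> = \<phi>, OF m j(1) uv(3,4) _ \<tau> \<tau> j(2)] uv
    show "\<exists>S. coloured_clique (m + 2) c (add_edge ?G e i) S" by blast
  qed
  also have "vertex_pairs (verts ?G) - D \<subseteq> {e \<in> vertex_pairs {..<n}. e \<inter> {..<s * m} \<noteq> {}}"
    unfolding verts D_def vertex_pairs_def by fastforce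
  then have "card (vertex_pairs (verts ?G) - D) \<le>
      card {e \<in> vertex_pairs {..<n}. e \<inter> {..<s * m} \<noteq> {}}"
    by (intro card_mono) (auto simp: finite_vertex_pairs)
  also have "\<dots> \<le> card {..<s * m} * card {..<n}" by (rule card_pairs_meeting_le) auto
  finally show ?thesis by simp
qed

lemma exists_surjective_on:
  assumes "finite A" "finite C" "C \<noteq> {}" "card C \<le> card A"
  shows "\<exists>\<phi>. range \<phi> \<subseteq> C \<and> \<phi> ` A = C"
proof -
  obtain g where g: "g ` C \<subseteq> A" "inj_on g C"
    using card_le_inj[OF assms(2,1,4)] by blast
  obtain c0 where c0: "c0 \<in> C" using assms by auto
  define \<phi> where "\<phi> a = (if a \<in> g ` C then inv_into C g a else c0)" for a
  have r: "range \<phi> \<subseteq> C" using c0 by (auto simp: \<phi>_def inv_into_into)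
  have "\<phi> (g x) = x" if "x \<in> C" for x using that g by (auto simp: \<phi>_def)
  then have "C \<subseteq> \<phi> ` A" using g(1) by force
  then show ?thesis using r by (intro exI[of _ \<phi>]) auto
qed

text \<open>
  If \<open>c \<ge> 2\<close>, the pattern uses \<open>c - 1\<close> colours other than \<open>i\<close>, and \<open>i\<close> on the new edge is the last one; if
  \<open>c = 1\<close>, everything has colour \<open>i\<close>. This uniform choice is why \<open>c - 1\<close> rather than \<open>c\<close> is compared with
  the number of pairs available, and hence why the threshold is where it is.
\<close>

lemma exists_colour_pattern:
  assumes "finite A" "1 \<le> c" "c \<le> t" "c - 1 \<le> card A" "i \<in> {1..t}"
  shows "\<exists>\<phi>. range \<phi> \<subseteq> {1..t} \<and> card (insert i (\<phi> ` A)) = c"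
proof (cases "c = 1")
  case True
  then show ?thesis using assms(5) by (intro exI[of _ "\<lambda>_. i"]) (auto simp: image_constant_conv)
next
  case False
  have "c - 1 \<le> card ({1..t} - {i})" using assms by simp
  then obtain C where C: "C \<subseteq> {1..t} - {i}" "card C = c - 1" "finite C"
    by (meson obtain_subset_with_card_n)
  then have "C \<noteq> {}" using False assms(2) by auto
  then obtain \<phi> where \<phi>: "range \<phi> \<subseteq> C" "\<phi> ` A = C"
    using exists_surjective_on[of A C] C assms by auto
  have "card (insert i C) = c" using C assms(2) by (subst card_insert_disjoint) auto
  then show ?thesis using \<phi> C by (intro exI[of _ \<phi>]) auto
qed

text \<open>
  With a single type, gadget \<open>j\<close> deals with the new edge in colour \<open>j + 1\<close>. The pairs
  available for the remaining colours are those of \<open>m + 1 = k - 1\<close> positions.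
\<close>

lemma sat_upper_linear:
  assumes m: "m > 0" and c: "1 \<le> c" "c \<le> t" "c \<le> (Suc m choose 2) + 1"
  shows "sat t n (colourings t c (complete_graph (m + 2))) \<le> t * m * n"
proof -
  let ?A = "vertex_pairs (insert m {..<m})"
  have "card ?A = Suc m choose 2" by (simp add: card_vertex_pairs)
  then have "\<exists>\<phi>. range \<phi> \<subseteq> {1..t} \<and> card (insert i (\<phi> ` ?A)) = c" if "i \<in> {1..t}" for i
    using that c by (intro exists_colour_pattern) (auto simp: finite_vertex_pairs)
  then obtain \<phi> where \<phi>: "range (\<phi> i) \<subseteq> {1..t}" "card (insert i (\<phi> i ` ?A)) = c"
    if "i \<in> {1..t}" for i by metis
  have t: "t \<ge> 1" using c by simp
  have mod: "Suc (j mod t) \<in> {1..t}" for j using t by (simp add: Suc_leI)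
  \<comment> \<open>Only \<open>j < t\<close> matters; \<open>mod\<close> keeps the patterns of the other indices within the colours.\<close>
  show ?thesis
  proof (rule sat_le_gadgets[OF m, where \<tau> = "\<lambda>_ _. m" and \<phi> = "\<lambda>j. \<phi> (Suc (j mod t))"])
    show "\<phi> (Suc (j mod t)) e \<in> {1..t}" for j e using \<phi>(1)[OF mod] by blast
    fix u v i :: nat assume i: "i \<in> {1..t}"
    then show "\<exists>j<t. card (insert i (\<phi> (Suc (j mod t)) ` (?A \<union> ?A))) = c"
      using \<phi>(2)[OF i] by (intro exI[of _ "i - 1"]) auto
  qed simp
qed

text \<open>
  Two distinct numbers below \<open>2 ^ L\<close> differ in one of their \<open>L\<close> binary digits. At a gadget whose types are
  given by that digit, the two vertices have different types, and then all pairs of the new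
  \<open>K\<^sub>k\<close> except the new edge can be coloured independently. The index \<open>j < t L\<close> encodes
  the digit \<open>j div t\<close> and the colour \<open>j mod t + 1\<close> of the new edge.
\<close>

lemma sat_upper_binary_digits:
  assumes m: "m > 0" and c: "1 \<le> c" "c \<le> t" "c \<le> (m + 2) choose 2" and L: "n \<le> 2 ^ L"
  shows "sat t n (colourings t c (complete_graph (m + 2))) \<le> (t * L) * m * n"
proof -
  let ?A = "vertex_pairs (insert m {..<m}) \<union> vertex_pairs (insert (Suc m) {..<m})"
  have "vertex_pairs {..<m + 2} = insert {m, Suc m} ?A"
    using vertex_pairs_insert2[of m "Suc m" "{..<m}"]
    by (simp add: lessThan_Suc insert_commute)
  moreover have fin: "finite ?A" by (simp add: finite_vertex_pairs)
  ultimately have "(m + 2) choose 2 \<le> Suc (card ?A)"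
    using card_vertex_pairs[of "{..<m + 2}"] card_insert_le_m1
    by (metis card_insert_if card_lessThan finite_lessThan le_SucI order_refl)
  then have "\<exists>\<phi>. range \<phi> \<subseteq> {1..t} \<and> card (insert i (\<phi> ` ?A)) = c" if "i \<in> {1..t}" for i
    using that c fin by (intro exists_colour_pattern) auto
  then obtain \<phi> where \<phi>: "range (\<phi> i) \<subseteq> {1..t}" "card (insert i (\<phi> i ` ?A)) = c"
    if "i \<in> {1..t}" for i by metis
  have t: "t \<ge> 1" using c by simp
  have mod: "Suc (j mod t) \<in> {1..t}" for j using t by (simp add: Suc_leI)
  let ?\<tau> = "\<lambda>j x. m + of_bool (bit x (j div t))"
  show ?thesis
  proof (rule sat_le_gadgets[OF m, where \<tau> = ?\<tau> and \<phi> = "\<lambda>j. \<phi> (Suc (j mod t))"])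
    show "\<phi> (Suc (j mod t)) e \<in> {1..t}" for j e using \<phi>(1)[OF mod] by blast
    fix u v i :: nat assume uv: "u < v" "v < n" and i: "i \<in> {1..t}"
    have "\<exists>p<L. bit u p \<noteq> bit v p"
    proof (rule ccontr)
      assume "\<not> ?thesis"
      then have "take_bit L u = take_bit L v" by (auto intro!: bit_eqI simp: bit_take_bit_iff)
      moreover have "u < 2 ^ L" "v < 2 ^ L" using uv L by auto
      ultimately show False using uv by (simp add: take_bit_nat_eq_self)
    qed
    then obtain p where p: "p < L" "bit u p \<noteq> bit v p" by blast
    define j where "j = p * t + (i - 1)"
    have "i - 1 < t" using i by auto
    then have j: "j div t = p" "j mod t = i - 1" unfolding j_def by auto
    have "j < Suc p * t" using \<open>i - 1 < t\<close> by (simp add: j_def)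
    also have "\<dots> \<le> L * t" using p(1) by (intro mult_le_mono1) simp
    finally have "j < t * L" by (simp add: mult.commute)
    moreover have "vertex_pairs (insert (?\<tau> j u) {..<m}) \<union> vertex_pairs (insert (?\<tau> j v) {..<m}) = ?A"
      using p(2) unfolding j by (cases "bit u p") auto
    moreover have "Suc (j mod t) = i" using j i by auto
    ultimately show "\<exists>j<t * L. card (insert i (\<phi> (Suc (j mod t)) `
        (vertex_pairs (insert (?\<tau> j u) {..<m}) \<union> vertex_pairs (insert (?\<tau> j v) {..<m})))) = c"
      using \<phi>(2)[OF i] by (intro exI[of _ j]) auto
  qed simp
qed

section \<open>Lower bounds\<close>

definition degree :: "'a cgraph \<Rightarrow> 'a \<Rightarrow> nat" where
  "degree G u = card {x \<in> verts G. {u, x} \<in> edges G}"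

lemma sum_degree:
  assumes "simple_graph G"
  shows "(\<Sum>u\<in>verts G. degree G u) = 2 * card (edges G)"
proof -
  have fin: "finite (verts G)" and E: "edges G \<subseteq> vertex_pairs (verts G)"
    using assms by (auto simp: simple_graph_def)
  have finE: "finite (edges G)" using fin E finite_vertex_pairs finite_subset by blast
  have "degree G u = card {e \<in> edges G. u \<in> e}" if u: "u \<in> verts G" for u
    unfolding degree_def
  proof (rule bij_betw_same_card[of "\<lambda>x. {u, x}"], unfold bij_betw_def, intro conjI)
    show "inj_on (\<lambda>x. {u, x}) {x \<in> verts G. {u, x} \<in> edges G}"
      by (auto simp: inj_on_def doubleton_eq_iff)
    show "(\<lambda>x. {u, x}) ` {x \<in> verts G. {u, x} \<in> edges G} = {e \<in> edges G. u \<in> e}"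
    proof safe
      fix e assume e: "e \<in> edges G" "u \<in> e"
      then obtain a b where "e = {a, b}" "a \<in> verts G" "b \<in> verts G"
        using E by (metis subsetD vertex_pairsE)
      with e show "e \<in> (\<lambda>x. {u, x}) ` {x \<in> verts G. {u, x} \<in> edges G}"
        by (auto simp: insert_commute)
    qed
  qed
  then have "(\<Sum>u\<in>verts G. degree G u) = (\<Sum>u\<in>verts G. card {e \<in> edges G. u \<in> e})" by simp
  also have "\<dots> = (\<Sum>u\<in>verts G. \<Sum>e\<in>edges G. of_bool (u \<in> e))"
    using finE by (intro sum.cong refl) (simp add: Int_def)
  also have "\<dots> = (\<Sum>e\<in>edges G. \<Sum>u\<in>verts G. of_bool (u \<in> e))" by (rule sum.swap)
  also have "\<dots> = (\<Sum>e\<in>edges G. card {u \<in> verts G. u \<in> e})"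
    using fin by (intro sum.cong refl) (simp add: Int_def)
  also have "\<dots> = (\<Sum>e\<in>edges G. 2)"
  proof (rule sum.cong[OF refl])
    fix e assume "e \<in> edges G"
    then have "e \<subseteq> verts G" "card e = 2" using E by (auto simp: vertex_pairs_def)
    moreover from this have "{u \<in> verts G. u \<in> e} = e" by auto
    ultimately show "card {u \<in> verts G. u \<in> e} = 2" by simp
  qed
  finally show ?thesis by simp
qed

text \<open>
  What saturation gives for a non-adjacent pair, with the new edge and its colour eliminated: a set
  which lacks only the edge \<open>uv\<close> to be a clique and shows at least \<open>c - 1\<close> colours.
\<close>

lemma saturated_nonadjacent:
  assumes sat: "saturated (colourings t c (complete_graph k)) t G" and t: "1 \<le> t"
    and uv: "u \<in> verts G" "v \<in> verts G" "u \<noteq> v" "{u, v} \<notin> edges G"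
  obtains S where "S \<subseteq> verts G" "card S = k" "u \<in> S" "v \<in> S"
    "vertex_pairs S - {{u, v}} \<subseteq> edges G"
    "c \<le> Suc (card (colour G ` (vertex_pairs S - {{u, v}})))"
proof -
  have "{u, v} \<in> vertex_pairs (verts G) - edges G" "1 \<in> {1..t}"
    using uv t by (auto simp: pair_in_vertex_pairs)
  then obtain S where S: "coloured_clique k c (add_edge G {u, v} 1) S"
    using sat unfolding saturated_complete_iff by blast
  have sub: "S \<subseteq> verts G" "card S = k" "vertex_pairs S - {{u, v}} \<subseteq> edges G"
    using S by (auto simp: coloured_clique_def add_edge_def)
  have "finite (verts G)" using sat by (auto simp: saturated_def edge_coloured_def simple_graph_def)
  then have fin: "finite (vertex_pairs S)" using sub(1) finite_vertex_pairs finite_subset by blast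
  have "{u, v} \<in> vertex_pairs S"
  proof (rule ccontr)
    assume no: "{u, v} \<notin> vertex_pairs S"
    then have "colour (add_edge G {u, v} 1) ` vertex_pairs S = colour G ` vertex_pairs S"
      by (intro image_cong) (auto simp: add_edge_def)
    then have "coloured_clique k c G S" using S no by (auto simp: coloured_clique_def add_edge_def)
    then show False using sat by (auto simp: saturated_complete_iff)
  qed
  then have "u \<in> S" "v \<in> S" by (auto simp: pair_in_vertex_pairs)
  moreover have "colour (add_edge G {u, v} 1) ` vertex_pairs S \<subseteq>
      insert 1 (colour G ` (vertex_pairs S - {{u, v}}))"
    by (auto simp: add_edge_def)
  then have "card (colour (add_edge G {u, v} 1) ` vertex_pairs S) \<le>
      card (insert 1 (colour G ` (vertex_pairs S - {{u, v}})))"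
    using fin by (intro card_mono) auto
  then have "c \<le> Suc (card (colour G ` (vertex_pairs S - {{u, v}})))"
    using S fin by (auto simp: coloured_clique_def card_insert_if split: if_splits)
  ultimately show ?thesis using that sub by blast
qed

lemma saturated_lower_linear:
  assumes sat: "saturated (colourings t c (complete_graph k)) t G"
    and t: "1 \<le> t" and k: "k \<ge> 3" and n: "card (verts G) \<ge> 2"
  shows "card (verts G) \<le> 2 * card (edges G)"
proof -
  have G: "simple_graph G" and fin: "finite (verts G)"
    using sat by (auto simp: saturated_def edge_coloured_def simple_graph_def)
  have "1 \<le> degree G u" if u: "u \<in> verts G" for u
  proof -
    have "\<exists>v\<in>verts G. v \<noteq> u"
      using n u by (metis One_nat_def card_le_Suc0_iff_eq fin not_less_eq_eq numeral_2_eq_2)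
    then obtain v where v: "v \<in> verts G" "u \<noteq> v" by blast
    have "\<exists>x\<in>verts G. {u, x} \<in> edges G"
    proof (cases "{u, v} \<in> edges G")
      case False
      from saturated_nonadjacent[OF sat t u v this] obtain S where S: "S \<subseteq> verts G" "card S = k" "u \<in> S" "v \<in> S"
         "vertex_pairs S - {{u, v}} \<subseteq> edges G" by metis
      have "\<not> S \<subseteq> {u, v}" using S(2) k card_mono[of "{u, v}" S] v(2) by auto
      then obtain x where x: "x \<in> S" "x \<noteq> u" "x \<noteq> v" by auto
      then have "{u, x} \<in> vertex_pairs S - {{u, v}}"
        using S by (auto simp: pair_in_vertex_pairs doubleton_eq_iff)
      then show ?thesis using S x by blast
    qed (use v in blast)
    then have "{x \<in> verts G. {u, x} \<in> edges G} \<noteq> {}" by blast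
    then show ?thesis unfolding degree_def using fin by (simp add: Suc_leI card_gt_0_iff)
  qed
  then have "(\<Sum>u\<in>verts G. 1) \<le> (\<Sum>u\<in>verts G. degree G u)" by (intro sum_mono) auto
  then show ?thesis using sum_degree[OF G] by simp
qed

text \<open>
  If every vertex of \<open>T = S - {u, v}\<close> were joined to \<open>u\<close> and \<open>v\<close> in the same colour, the \<open>K\<^sub>k\<close> without the edge
  \<open>uv\<close> would have no more colours than its \<open>k - 1\<close> vertices other than \<open>u\<close>, hence at most
  \<open>(k - 1) choose 2\<close>, and the new edge adds only one.
\<close>

lemma saturated_distinguishing_neighbour:
  assumes sat: "saturated (colourings t c (complete_graph k)) t G"
    and t: "1 \<le> t" and c: "c \<ge> ((k - 1) choose 2) + 2"
    and uv: "u \<in> verts G" "v \<in> verts G" "u \<noteq> v" "{u, v} \<notin> edges G"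
  shows "\<exists>x\<in>verts G. {u, x} \<in> edges G \<and> {v, x} \<in> edges G \<and> colour G {u, x} \<noteq> colour G {v, x}"
proof (rule ccontr)
  assume no: "\<not> ?thesis"
  obtain S where S: "S \<subseteq> verts G" "card S = k" "u \<in> S" "v \<in> S"
    "vertex_pairs S - {{u, v}} \<subseteq> edges G"
    "c \<le> Suc (card (colour G ` (vertex_pairs S - {{u, v}})))"
    using saturated_nonadjacent[OF sat t uv] .
  have fin: "finite S"
    using S(1) sat by (auto simp: saturated_def edge_coloured_def simple_graph_def intro: finite_subset)
  define T where "T = S - {u, v}"
  have ST: "S = insert u (insert v T)" using S by (auto simp: T_def)
  have eq: "colour G {u, x} = colour G {v, x}" if "x \<in> T" for x
  proof -
    have "{u, x} \<in> edges G" "{v, x} \<in> edges G" "x \<in> verts G"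
      using that S by (auto simp: T_def pair_in_vertex_pairs doubleton_eq_iff intro!: subsetD[OF S(5)])
    then show ?thesis using no by blast
  qed
  have "colour G ` (vertex_pairs S - {{u, v}}) \<subseteq> colour G ` vertex_pairs (insert v T)"
  proof (rule image_subsetI)
    fix e assume "e \<in> vertex_pairs S - {{u, v}}"
    then have "e \<in> vertex_pairs (insert u T) \<or> e \<in> vertex_pairs (insert v T)"
      unfolding ST vertex_pairs_insert2[OF uv(3)] by blast
    then show "colour G e \<in> colour G ` vertex_pairs (insert v T)"
    proof
      assume "e \<in> vertex_pairs (insert u T)"
      then obtain a b where ab: "e = {a, b}" "a \<noteq> b" "a \<in> insert u T" "b \<in> insert u T"
        by (rule vertex_pairsE)
      show ?thesis
      proof (cases "u \<in> e")
        case True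
        with ab obtain x where x: "e = {u, x}" "x \<in> T" by (auto simp: insert_commute)
        then have "colour G e = colour G {v, x}" "{v, x} \<in> vertex_pairs (insert v T)"
          using eq by (auto simp: pair_in_vertex_pairs T_def)
        then show ?thesis by (metis imageI)
      next
        case False
        then have "e \<in> vertex_pairs (insert v T)" using ab by (auto simp: pair_in_vertex_pairs)
        then show ?thesis by blast
      qed
    qed blast
  qed
  moreover have finT: "finite (vertex_pairs (insert v T))"
    using fin by (simp add: T_def finite_vertex_pairs)
  ultimately have "card (colour G ` (vertex_pairs S - {{u, v}})) \<le>
      card (colour G ` vertex_pairs (insert v T))"
    by (intro card_mono) auto
  also have "\<dots> \<le> card (vertex_pairs (insert v T))" using finT by (rule card_image_le)
  also have "\<dots> = (k - 1) choose 2"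
  proof -
    have "insert v T = S - {u}" using S uv by (auto simp: T_def)
    then show ?thesis using fin S by (simp add: card_vertex_pairs)
  qed
  finally show False using S(6) c by simp
qed

text \<open>
  Let \<open>f\<close> choose a colour at each vertex, and let a vertex \<open>u\<close> survive if each edge \<open>ux\<close> has colour \<open>f x\<close>. Two
  non-adjacent vertices cannot both survive, because of the neighbour that distinguishes them. Each
  \<open>u\<close> survives for a fraction \<open>t ^ (- degree u)\<close> of all \<open>f\<close>, so the sum in the conclusion is the average number of
  survivors, and some \<open>f\<close> reaches it.
\<close>

lemma exists_large_clique:
  assumes G: "edge_coloured t G" and t: "1 \<le> t"
    and sep: "\<And>u v. u \<in> verts G \<Longrightarrow> v \<in> verts G \<Longrightarrow> u \<noteq> v \<Longrightarrow> {u, v} \<notin> edges G \<Longrightarrow>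
      \<exists>x\<in>verts G. {u, x} \<in> edges G \<and> {v, x} \<in> edges G \<and> colour G {u, x} \<noteq> colour G {v, x}"
  shows "\<exists>K\<subseteq>verts G. vertex_pairs K \<subseteq> edges G \<and>
           (\<Sum>u\<in>verts G. 1 / real t ^ degree G u) \<le> real (card K)"
proof -
  let ?V = "verts G" and ?n = "card (verts G)"
  have fin: "finite ?V" using G by (auto simp: edge_coloured_def simple_graph_def)
  define F where "F = (\<Pi>\<^sub>E x\<in>?V. {1..t})"
  define surv where "surv f = {u \<in> ?V. \<forall>x\<in>?V. {u, x} \<in> edges G \<longrightarrow> f x = colour G {u, x}}" for f
  have finF: "finite F" unfolding F_def using fin by (intro finite_PiE) auto
  have cardF: "card F = t ^ ?n" unfolding F_def using fin by (simp add: card_PiE)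
  have clique: "vertex_pairs (surv f) \<subseteq> edges G" for f
  proof
    fix e assume "e \<in> vertex_pairs (surv f)"
    then obtain u v where uv: "e = {u, v}" "u \<noteq> v" "u \<in> surv f" "v \<in> surv f"
      by (rule vertex_pairsE)
    show "e \<in> edges G"
    proof (rule ccontr)
      assume "e \<notin> edges G"
      with sep[of u v] uv obtain x where "x \<in> verts G" "{u, x} \<in> edges G" "{v, x} \<in> edges G"
          "colour G {u, x} \<noteq> colour G {v, x}" by (auto simp: surv_def)
      then show False using uv(3,4) by (auto simp: surv_def)
    qed
  qed
  \<comment> \<open>The value of \<open>f\<close> is forced at the neighbours of \<open>u\<close> and free elsewhere.\<close>
  have cnt: "real (card {f \<in> F. u \<in> surv f}) = real t ^ ?n * (1 / real t ^ degree G u)"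
    if u: "u \<in> ?V" for u
  proof -
    let ?N = "{x \<in> ?V. {u, x} \<in> edges G}"
    have "{f \<in> F. u \<in> surv f} = (\<Pi>\<^sub>E x\<in>?V. if {u, x} \<in> edges G then {colour G {u, x}} else {1..t})"
    proof (intro set_eqI iffI)
      fix f assume "f \<in> {f \<in> F. u \<in> surv f}"
      then show "f \<in> (\<Pi>\<^sub>E x\<in>?V. if {u, x} \<in> edges G then {colour G {u, x}} else {1..t})"
        unfolding F_def surv_def PiE_iff by auto
    next
      fix f assume f: "f \<in> (\<Pi>\<^sub>E x\<in>?V. if {u, x} \<in> edges G then {colour G {u, x}} else {1..t})"
      have "f x \<in> {1..t} \<and> ({u, x} \<in> edges G \<longrightarrow> f x = colour G {u, x})" if "x \<in> ?V" for x
        using f that G unfolding PiE_iff edge_coloured_def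
        by (cases "{u, x} \<in> edges G") (force simp: image_subset_iff)+
      then show "f \<in> {f \<in> F. u \<in> surv f}" using f u by (auto simp: F_def surv_def PiE_iff)
    qed
    then have "card {f \<in> F. u \<in> surv f} = (\<Prod>x\<in>?V. if {u, x} \<in> edges G then 1 else t)"
      using fin by (simp add: card_PiE if_distrib cong: if_cong)
    also have "\<dots> = t ^ card (?V - ?N)"
      using fin by (simp add: prod.If_cases Diff_eq Collect_neg_eq Int_def conj_commute)
        (auto intro!: arg_cong[of _ _ "\<lambda>A. t ^ card A"])
    finally have "real (card {f \<in> F. u \<in> surv f}) * real t ^ degree G u =
        real t ^ (card (?V - ?N) + card ?N)"
      by (simp add: degree_def power_add)
    also have "card (?V - ?N) + card ?N = ?n"
      using fin card_Int_Diff[of ?V ?N] by (simp add: Int_def)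
    finally show ?thesis using t by (simp add: field_simps)
  qed
  have "(\<Sum>f\<in>F. real (card (surv f))) = (\<Sum>f\<in>F. \<Sum>u\<in>?V. of_bool (u \<in> surv f))"
    using fin by (intro sum.cong refl) (simp add: surv_def Int_def)
  also have "\<dots> = (\<Sum>u\<in>?V. \<Sum>f\<in>F. of_bool (u \<in> surv f))" by (rule sum.swap)
  also have "\<dots> = (\<Sum>u\<in>?V. real (card {f \<in> F. u \<in> surv f}))"
    using finF by (intro sum.cong refl) (simp add: Int_def)
  also have "\<dots> = real t ^ ?n * (\<Sum>u\<in>?V. 1 / real t ^ degree G u)"
    unfolding sum_distrib_left by (rule sum.cong[OF refl cnt])
  finally have total: "(\<Sum>f\<in>F. real (card (surv f))) = real t ^ ?n * (\<Sum>u\<in>?V. 1 / real t ^ degree G u)" .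
  have "\<exists>f\<in>F. (\<Sum>u\<in>?V. 1 / real t ^ degree G u) \<le> real (card (surv f))"
  proof (rule ccontr)
    assume "\<not> ?thesis"
    moreover have "F \<noteq> {}" using cardF t by auto
    ultimately have "(\<Sum>f\<in>F. real (card (surv f))) < (\<Sum>f\<in>F. (\<Sum>u\<in>?V. 1 / real t ^ degree G u))"
      using finF by (intro sum_strict_mono) auto
    then show False using total cardF by simp
  qed
  then obtain f where "(\<Sum>u\<in>?V. 1 / real t ^ degree G u) \<le> real (card (surv f))" by blast
  then show ?thesis using clique[of f] by (intro exI[of _ "surv f"]) (auto simp: surv_def)
qed

text \<open>
  Jensen's inequality for \<open>exp\<close>, by bounding each term from below by the tangent at the mean.
\<close>

lemma sum_exp_ge_exp_mean:
  fixes x :: "'a \<Rightarrow> real"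
  assumes "finite V" "V \<noteq> {}"
  shows "real (card V) * exp (- (\<Sum>u\<in>V. x u) / real (card V)) \<le> (\<Sum>u\<in>V. exp (- x u))"
proof -
  define a where "a = (\<Sum>u\<in>V. x u) / real (card V)"
  have n: "real (card V) > 0" using assms by (simp add: card_gt_0_iff)
  have "exp (- a) * (1 + (a - x u)) \<le> exp (- x u)" for u
  proof -
    have "exp (- a) * (1 + (a - x u)) \<le> exp (- a) * exp (a - x u)"
      by (intro mult_left_mono) auto
    also have "\<dots> = exp (- x u)" by (simp flip: exp_add)
    finally show ?thesis .
  qed
  then have "(\<Sum>u\<in>V. exp (- a) * (1 + (a - x u))) \<le> (\<Sum>u\<in>V. exp (- x u))" by (intro sum_mono)
  also have "(\<Sum>u\<in>V. exp (- a) * (1 + (a - x u))) = exp (- a) * real (card V)"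
    using n by (simp add: sum.distrib sum_subtractf a_def flip: sum_distrib_left)
  finally show ?thesis by (simp add: a_def mult.commute)
qed

text \<open>
  The constant \<open>C\<close> is chosen so that, with fewer than \<open>C n ln n\<close> edges, the average degree \<open>d\<close> satisfies
  \<open>n t ^ (- d) \<ge> n powr (3/4)\<close>. A clique of that size has about \<open>n powr (3/2) / 2\<close> edges, which for
  large \<open>n\<close> is too many; how large is left to the last assumption.
\<close>

lemma saturated_lower_log:
  fixes G :: "'a cgraph" and k t c :: nat
  defines "C \<equiv> 1 / (8 * ln (real t))" and "n \<equiv> card (verts G)"
  assumes sat: "saturated (colourings t c (complete_graph k)) t G"
    and t: "2 \<le> t" and c: "c \<ge> ((k - 1) choose 2) + 2"
    and n: "n \<ge> 1"
    and large: "C * (real n * ln (real n)) \<le> real n powr (3/4) * (real n powr (3/4) - 1) / 2"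
  shows "C * (real n * ln (real n)) \<le> real (card (edges G))"
proof (rule ccontr)
  assume "\<not> ?thesis"
  then have few: "real (card (edges G)) < C * (real n * ln (real n))" by simp
  have col: "edge_coloured t G" and G: "simple_graph G" and fin: "finite (verts G)"
    using sat by (auto simp: saturated_def edge_coloured_def simple_graph_def)
  have ne: "verts G \<noteq> {}" using n by (auto simp: n_def)
  define b where "b = ln (real t)"
  have b: "b > 0" using t by (simp add: b_def)
  obtain K where K: "K \<subseteq> verts G" "vertex_pairs K \<subseteq> edges G"
      "(\<Sum>u\<in>verts G. 1 / real t ^ degree G u) \<le> real (card K)"
    using exists_large_clique[OF col _ saturated_distinguishing_neighbour[OF sat _ c]] t by auto
  \<comment> \<open>The survival probabilities in exponential form, ready for convexity.\<close>
  have pw: "1 / real t ^ d = exp (- (b * real d))" for d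
    using t by (simp add: b_def exp_minus exp_of_nat_mult field_simps)
  have "(\<Sum>u\<in>verts G. b * real (degree G u)) = b * (2 * real (card (edges G)))"
    using sum_degree[OF G] by (simp flip: sum_distrib_left of_nat_sum)
  then have "real n * exp (- (b * (2 * real (card (edges G)))) / real n) \<le> real (card K)"
    using sum_exp_ge_exp_mean[OF fin ne, of "\<lambda>u. b * real (degree G u)"] K(3)
    unfolding pw n_def by simp
  moreover have "real n powr (3/4) \<le> real n * exp (- (b * (2 * real (card (edges G)))) / real n)"
  proof -
    have "b * (2 * real (card (edges G))) / real n \<le> b * (2 * (C * (real n * ln (real n)))) / real n"
      using few b n by (intro divide_right_mono mult_left_mono) auto
    also have "\<dots> = ln (real n) / 4" using b n by (simp add: C_def b_def field_simps)
    finally have "ln (real n) + (- (b * (2 * real (card (edges G)))) / real n) \<ge> 3/4 * ln (real n)"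
      by simp
    then have "exp (3/4 * ln (real n)) \<le> exp (ln (real n) + (- (b * (2 * real (card (edges G)))) / real n))"
      by (simp only: exp_le_cancel_iff)
    moreover have "exp (3/4 * ln (real n)) = real n powr (3/4)" "exp (ln (real n)) = real n"
      using n by (auto simp: powr_def)
    ultimately show ?thesis unfolding exp_add by simp
  qed
  ultimately have big: "real n powr (3/4) \<le> real (card K)" by linarith
  have "1 \<le> real n powr (3/4)" using n by (intro ge_one_powr_ge_zero) auto
  then have "real n powr (3/4) * (real n powr (3/4) - 1) \<le> real (card K) * (real (card K) - 1)"
    using big by (intro mult_mono) auto
  also have "\<dots> = real (2 * (card K choose 2))"
  proof -
    have "even (card K * (card K - 1))" by (cases "card K") auto
    then have "2 * (card K choose 2) = card K * (card K - 1)" by (simp add: choose_two)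
    then show ?thesis by (cases "card K") (auto simp: algebra_simps)
  qed
  finally have "real n powr (3/4) * (real n powr (3/4) - 1) / 2 \<le> real (card K choose 2)" by simp
  also have "card K choose 2 \<le> card (edges G)"
    using card_vertex_pairs[of K] K(1,2) G fin
    by (metis card_mono finite_subset finite_vertex_pairs simple_graph_def)
  finally show False using few large by simp
qed

section \<open>The dichotomy\<close>

theorem theorem1:
  fixes k t c :: nat
  assumes "k \<ge> 3" and "t \<ge> c" and "1 \<le> c" and "c \<le> (k choose 2)"
  shows "(c \<ge> ((k - 1) choose 2) + 2 \<longrightarrow>
            (\<lambda>n. real (sat t n (colourings t c (complete_graph k)))) \<in> \<Theta>(\<lambda>n. real n * ln (real n))) \<and>
         (c \<le> ((k - 1) choose 2) + 1 \<longrightarrow>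
            (\<lambda>n. real (sat t n (colourings t c (complete_graph k)))) \<in> \<Theta>(\<lambda>n. real n))"
proof (intro conjI impI)
  let ?s = "\<lambda>n. real (sat t n (colourings t c (complete_graph k)))"
  define m where "m = k - 2"
  have m: "m > 0" "k = m + 2" "k - 1 = Suc m" using assms(1) by (auto simp: m_def)
  have t1: "1 \<le> t" using assms by simp
  {
    assume c: "c \<ge> ((k - 1) choose 2) + 2"
    have t2: "2 \<le> t" using c assms(2) by simp
    show "?s \<in> \<Theta>(\<lambda>n. real n * ln (real n))"
    proof (rule bigthetaI)
      have "?s n \<le> real (t * m) * ((log 2 (real n) + 1) * real n)" if n: "n \<ge> 1" for n
      proof -
        define L where "L = nat \<lceil>log 2 (real n)\<rceil>"
        have L: "log 2 (real n) \<le> real L" "real L \<le> log 2 (real n) + 1"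
          using n unfolding L_def by (auto simp: real_nat_ceiling_ge)
        have "real n \<le> 2 ^ L" using L(1) n by (simp add: log_le_iff powr_realpow)
        then have "n \<le> 2 ^ L" by (metis of_nat_le_iff of_nat_numeral of_nat_power)
        then have "sat t n (colourings t c (complete_graph k)) \<le> (t * L) * m * n"
          unfolding m(2) using assms m by (intro sat_upper_binary_digits) auto
        then have "?s n \<le> real ((t * L) * m * n)" by (simp only: of_nat_le_iff)
        also have "\<dots> = real (t * m) * (real L * real n)" by simp
        also have "\<dots> \<le> real (t * m) * ((log 2 (real n) + 1) * real n)"
          using L(2) by (intro mult_left_mono mult_right_mono) auto
        finally show ?thesis .
      qed
      then have "?s \<in> O(\<lambda>n. real (t * m) * ((log 2 (real n) + 1) * real n))"
        by (intro landau_o.big_mono eventually_mono[OF eventually_ge_at_top[of 1]]) force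
      also have "(\<lambda>n. real (t * m) * ((log 2 (real n) + 1) * real n)) \<in> O(\<lambda>n. (log 2 (real n) + 1) * real n)"
        by simp
      also have "(\<lambda>n. (log 2 (real n) + 1) * real n) \<in> O(\<lambda>n. real n * ln (real n))"
        by real_asymp
      finally show "?s \<in> O(\<lambda>n. real n * ln (real n))" .
    next
      define C where "C = 1 / (8 * ln (real t))"
      have C: "C > 0" using t2 by (simp add: C_def)
      have "eventually (\<lambda>n::nat. C * (real n * ln (real n)) \<le>
          real n powr (3/4) * (real n powr (3/4) - 1) / 2) at_top"
        using C by real_asymp
      then have "eventually (\<lambda>n. C * (real n * ln (real n)) \<le> ?s n) at_top"
        using eventually_ge_at_top[of 1]
      proof eventually_elim
        case (elim n)
        obtain G :: "nat cgraph" where G: "saturated (colourings t c (complete_graph k)) t G"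
          "card (verts G) = n" "card (edges G) = sat t n (colourings t c (complete_graph k))"
          using sat_attained[of k t c n] assms by auto
        show ?case
          using saturated_lower_log[OF G(1) t2 c] elim unfolding G(2,3) C_def by simp
      qed
      then have "eventually (\<lambda>n. C * norm (real n * ln (real n)) \<le> norm (?s n)) at_top"
        using eventually_ge_at_top[of 1] by eventually_elim (simp add: abs_mult)
      then show "?s \<in> \<Omega>(\<lambda>n. real n * ln (real n))"
        using C by (rule landau_omega.bigI[rotated])
    qed
  next
    assume c: "c \<le> ((k - 1) choose 2) + 1"
    show "?s \<in> \<Theta>(\<lambda>n. real n)"
    proof (rule bigthetaI)
      have "?s n \<le> real (t * m) * real n" for n
        using sat_upper_linear[of m c t n] assms m c
        by (simp only: of_nat_mult[symmetric] of_nat_le_iff) 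
      then show "?s \<in> O(\<lambda>n. real n)"
        by (intro bigoI[of _ "real (t * m)"] always_eventually) auto
    next
      have "1 / 2 * real n \<le> ?s n" if "n \<ge> 2" for n
      proof -
        obtain G :: "nat cgraph" where G: "saturated (colourings t c (complete_graph k)) t G"
          "card (verts G) = n" "card (edges G) = sat t n (colourings t c (complete_graph k))"
          using sat_attained[of k t c n] assms by auto
        then show ?thesis using saturated_lower_linear[OF G(1) t1 assms(1)] that by simp
      qed
      then show "?s \<in> \<Omega>(\<lambda>n. real n)"
        by (intro landau_omega.bigI[of "1/2"] eventually_mono[OF eventually_ge_at_top[of 2]]) auto
    qed
  }
qed

end
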